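(* Let $n$ be a positive integer and $B_n$ the Boolean lattice of subsets of $\{1,2,\dots,n\}$ ordered by inclusion. Then $\chi_D(B_n)\le n+3$.
   Context: For a finite poset $P$, a coloring is proper if comparable points get different colors and distinguishing if the only color-preserving automorphism of $P$ is the identity; $\chi_D(P)$ is the least number of colors in a proper distinguishing coloring of $P$. *)

theory Defs
  imports Main
begin

text \<open>A poset is a carrier \<^term>\<open>A\<close> with a relation \<^term>\<open>r\<close> such that
  \<^term>\<open>partial_order_on A r\<close>. Automorphisms are functions on the whole type, and only
  their restriction to \<^term>\<open>A\<close> matters.\<close>

definition poset_automorphism :: "'a set \<Rightarrow> 'a rel \<Rightarrow> ('a \<Rightarrow> 'a) \<Rightarrow> bool" where
  "poset_automorphism A r f \<longleftrightarrow>
     bij_betw f A A \<and> (\<forall>x\<in>A. \<forall>y\<in>A. (x, y) \<in> r \<longleftrightarrow> (f x, f y) \<in> r)"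

definition proper_coloring :: "'a set \<Rightarrow> 'a rel \<Rightarrow> ('a \<Rightarrow> 'c) \<Rightarrow> bool" where
  "proper_coloring A r c \<longleftrightarrow>
     (\<forall>x\<in>A. \<forall>y\<in>A. x \<noteq> y \<and> ((x, y) \<in> r \<or> (y, x) \<in> r) \<longrightarrow> c x \<noteq> c y)"

definition distinguishing_coloring :: "'a set \<Rightarrow> 'a rel \<Rightarrow> ('a \<Rightarrow> 'c) \<Rightarrow> bool" where
  "distinguishing_coloring A r c \<longleftrightarrow>
     (\<forall>f. poset_automorphism A r f \<and> (\<forall>x\<in>A. c (f x) = c x) \<longrightarrow> (\<forall>x\<in>A. f x = x))"

definition proper_distinguishing_colorable :: "'a set \<Rightarrow> 'a rel \<Rightarrow> nat \<Rightarrow> bool" where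
  "proper_distinguishing_colorable A r k \<longleftrightarrow>
     (\<exists>c :: 'a \<Rightarrow> nat. c ` A \<subseteq> {..<k} \<and> proper_coloring A r c \<and> distinguishing_coloring A r c)"

definition distinguishing_chromatic_number :: "'a set \<Rightarrow> 'a rel \<Rightarrow> nat" where
  "distinguishing_chromatic_number A r = (LEAST k. proper_distinguishing_colorable A r k)"

definition boolean_lattice_carrier :: "nat \<Rightarrow> nat set set" where
  "boolean_lattice_carrier n = Pow {1..n}"

definition boolean_lattice_order :: "nat \<Rightarrow> nat set rel" where
  "boolean_lattice_order n = {(S, T). S \<subseteq> T \<and> T \<subseteq> {1..n}}"

lemma partial_order_boolean_lattice:
  "partial_order_on (boolean_lattice_carrier n) (boolean_lattice_order n)"
  unfolding boolean_lattice_carrier_def boolean_lattice_order_def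
    partial_order_on_def preorder_on_def refl_on_def trans_def antisym_def
  by auto

text \<open>For a finite poset the minimum is taken over a nonempty set: color the points injectively.\<close>

lemma finite_proper_distinguishing_colorable:
  assumes "finite A"
  shows "proper_distinguishing_colorable A r (card A)"
proof -
  obtain c :: "'a \<Rightarrow> nat" where c: "bij_betw c A {0..<card A}"
    using ex_bij_betw_finite_nat[OF assms] by blast
  then have inj: "inj_on c A" and img: "c ` A = {0..<card A}"
    by (auto simp: bij_betw_def)
  have "proper_coloring A r c"
    using inj by (auto simp: proper_coloring_def inj_on_def)
  moreover have "distinguishing_coloring A r c"
    unfolding distinguishing_coloring_def poset_automorphism_def
    by (metis inj bij_betwE inj_onD)
  ultimately show ?thesis
    unfolding proper_distinguishing_colorable_def
    using img by (intro exI[of _ c]) auto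
qed

lemma distinguishing_chromatic_number_colorable:
  assumes "finite A"
  shows "proper_distinguishing_colorable A r (distinguishing_chromatic_number A r)"
  unfolding distinguishing_chromatic_number_def
  by (rule LeastI) (rule finite_proper_distinguishing_colorable[OF assms])

end

theory Submission
  imports Defs
begin

text \<open>Color every set by its size, except that the singleton of \<open>1\<close> gets one new color and the
  consecutive pairs \<open>{i, i + 1}\<close> get another. Each color class consists of sets of one size, so
  the coloring is proper and every color-preserving automorphism preserves sizes. On the atoms such
  an automorphism acts as an automorphism of the path \<open>1, 2, \<dots>, n\<close> that fixes the endpoint \<open>1\<close>;
  walking along the path, it fixes every atom, and hence every set.\<close>

definition path_coloring :: "nat \<Rightarrow> nat set \<Rightarrow> nat" where
  "path_coloring n S =
     (if S = {1} then n + 1 else if \<exists>i. S = {i, Suc i} then n + 2 else card S)"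

text \<open>Sizes of subsets of \<open>{1..n}\<close> are at most \<open>n\<close>, so the extra
  colors \<open>n + 1\<close> and \<open>n + 2\<close> never collide with a size; the two special
  cases are disjoint because \<open>i\<close> and \<open>Suc i\<close> differ.\<close>

lemma path_coloring_eq_iff:
  assumes "S \<subseteq> {1..n}"
  shows "path_coloring n S = n + 1 \<longleftrightarrow> S = {1}"
    and "path_coloring n S = n + 2 \<longleftrightarrow> (\<exists>i. S = {i, Suc i})"
    and "path_coloring n S < n + 3"
proof -
  have "card S \<le> n"
    using card_mono[OF _ assms] by simp
  moreover have "{1} \<noteq> {i, Suc i}" for i
    by (auto simp: doubleton_eq_iff)
  ultimately show "path_coloring n S = n + 1 \<longleftrightarrow> S = {1}"
    and "path_coloring n S = n + 2 \<longleftrightarrow> (\<exists>i. S = {i, Suc i})"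
    and "path_coloring n S < n + 3"
    by (auto simp: path_coloring_def)
qed

text \<open>Each extra color is confined to one size (1 for \<open>n + 1\<close>, 2 for
  \<open>n + 2\<close>); any other color is the size itself.\<close>

lemma path_coloring_eq_imp_card_eq:
  assumes "S \<subseteq> {1..n}" "T \<subseteq> {1..n}" "path_coloring n S = path_coloring n T"
  shows "card S = card T"
proof (cases "path_coloring n S = n + 1 \<or> path_coloring n S = n + 2")
  case True
  then show ?thesis
    using assms path_coloring_eq_iff(1,2)[of S n] path_coloring_eq_iff(1,2)[of T n] by auto
next
  case False
  then show ?thesis
    using assms by (auto simp: path_coloring_def split: if_splits)
qed

lemma proper_path_coloring:
  "proper_coloring (boolean_lattice_carrier n) (boolean_lattice_order n) (path_coloring n)"
proof -
  have "S = T" if "S \<subseteq> T" "T \<subseteq> {1..n}" "path_coloring n S = path_coloring n T" for S T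
  proof -
    have "card S = card T"
      using that by (intro path_coloring_eq_imp_card_eq) auto
    then show ?thesis
      using card_subset_eq[of T S] that finite_subset[of T] by blast
  qed
  then have "S = T" if "(S, T) \<in> boolean_lattice_order n" "path_coloring n S = path_coloring n T"
    for S T
    using that by (simp add: boolean_lattice_order_def)
  then show ?thesis
    unfolding proper_coloring_def by metis
qed

lemma distinguishing_path_coloring:
  "distinguishing_coloring (boolean_lattice_carrier n) (boolean_lattice_order n) (path_coloring n)"
  unfolding distinguishing_coloring_def
proof (intro allI impI ballI)
  fix f S
  assume f: "poset_automorphism (boolean_lattice_carrier n) (boolean_lattice_order n) f \<and>
      (\<forall>S\<in>boolean_lattice_carrier n. path_coloring n (f S) = path_coloring n S)"
    and "S \<in> boolean_lattice_carrier n"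
  then have S: "S \<subseteq> {1..n}"
    by (simp add: boolean_lattice_carrier_def)
  have bij: "bij_betw f (Pow {1..n}) (Pow {1..n})"
    using f by (simp add: poset_automorphism_def boolean_lattice_carrier_def)
  have closed: "f S \<subseteq> {1..n}" if "S \<subseteq> {1..n}" for S
    using bij_betwE[OF bij] that by blast
  have mono_iff: "f S \<subseteq> f T \<longleftrightarrow> S \<subseteq> T" if "S \<subseteq> {1..n}" "T \<subseteq> {1..n}" for S T
    using f that closed[OF that(2)]
    by (simp add: poset_automorphism_def boolean_lattice_carrier_def boolean_lattice_order_def)
  have color: "path_coloring n (f S) = path_coloring n S" if "S \<subseteq> {1..n}" for S
    using f that by (simp add: boolean_lattice_carrier_def)
  have card: "card (f S) = card S" if "S \<subseteq> {1..n}" for S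
    by (rule path_coloring_eq_imp_card_eq[OF closed[OF that] that color[OF that]])
  \<comment> \<open>Strong induction, since the step for \<open>k\<close> uses both preceding atoms,
    \<open>{k - 1}\<close> and, where it exists, \<open>{k - 2}\<close>.\<close>
  have atom: "f {k} = {k}" if "1 \<le> k" "k \<le> n" for k
    using that
  proof (induction k rule: less_induct)
    case (less k)
    show ?case
    proof (cases "k = 1")
      case True
      then show ?thesis
        using less.prems color[of "{1}"] closed[of "{1}"] path_coloring_eq_iff(1)[of "{1}" n]
          path_coloring_eq_iff(1)[of "f {1}" n] by auto
    next
      case False
      then obtain i where k: "k = Suc i" and i: "1 \<le> i"
        using less.prems by (cases k) auto
      have sub: "{i, k} \<subseteq> {1..n}"
        using k i less.prems by auto
      have fi: "f {i} = {i}"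
        using less.IH[of i] k i less.prems by simp
      have "path_coloring n (f {i, k}) = n + 2"
        using color[OF sub] path_coloring_eq_iff(2)[OF sub] k by auto
      then obtain j where j: "f {i, k} = {j, Suc j}"
        using path_coloring_eq_iff(2)[OF closed[OF sub]] by blast
      have "f {i} \<subseteq> f {i, k}"
        using mono_iff[of "{i}" "{i, k}"] sub by simp
      then have "i = j \<or> i = Suc j"
        using fi j by auto
      \<comment> \<open>The walk cannot turn back: otherwise the already fixed atom
        \<open>{j}\<close> would lie below \<open>f {i, k}\<close>, hence below
        \<open>{i, k}\<close>, although \<open>j < i < k\<close>.\<close>
      moreover have "i \<noteq> Suc j"
      proof
        assume ij: "i = Suc j"
        then have "1 \<le> j"
          using closed[OF sub] j by auto
        then have "f {j} = {j}" "{j} \<subseteq> {1..n}"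
          using less.IH[of j] k ij less.prems by auto
        then have "{j} \<subseteq> {i, k}"
          using mono_iff[of "{j}" "{i, k}"] sub j by simp
        then show False
          using ij k by simp
      qed
      ultimately have "f {i, k} = {i, k}"
        using j k by simp
      then have "f {k} \<subseteq> {i, k}"
        using mono_iff[of "{k}" "{i, k}"] sub by simp
      moreover obtain m where m: "f {k} = {m}"
        using card[of "{k}"] sub by (auto simp: card_1_singleton_iff)
      \<comment> \<open>Otherwise \<open>f {k} = f {i}\<close>, and reflecting the order would give
        \<open>{k} \<subseteq> {i}\<close>.\<close>
      moreover have "m \<noteq> i"
        using mono_iff[of "{k}" "{i}"] fi m k sub by auto
      ultimately show ?thesis
        by simp
    qed
  qed
  \<comment> \<open>Membership of \<open>x\<close> is the relation \<open>{x} \<subseteq> S\<close>,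
    which \<open>f\<close> preserves and reflects while fixing \<open>{x}\<close>.\<close>
  have "x \<in> f S \<longleftrightarrow> x \<in> S" if "x \<in> {1..n}" for x
    using mono_iff[of "{x}" S] atom[of x] that S by simp
  then show "f S = S"
    using S closed[OF S] by blast
qed

theorem theorem4p9:
  fixes n :: nat
  assumes "n \<ge> 1"
  shows "distinguishing_chromatic_number (boolean_lattice_carrier n) (boolean_lattice_order n) \<le> n + 3"
proof -
  have "path_coloring n ` boolean_lattice_carrier n \<subseteq> {..<n + 3}"
    using path_coloring_eq_iff(3) by (auto simp: boolean_lattice_carrier_def)
  then have "proper_distinguishing_colorable (boolean_lattice_carrier n) (boolean_lattice_order n) (n + 3)"
    unfolding proper_distinguishing_colorable_def
    using proper_path_coloring distinguishing_path_coloring by blast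
  then show ?thesis
    unfolding distinguishing_chromatic_number_def by (rule Least_le)
qed

end
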